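(* Let $m\ge2$ be an integer and let $\alpha_0,\dots,\alpha_{m-1}$ be nonnegative reals with $\sum_{i=0}^{m-1}\alpha_i=1$. With the $m\times m$ matrices $\mathbf T_k$, $\mathbf T=\mathbf T_m\cdots\mathbf T_1$, $\mathbf A$, $R$, $L$ defined in the context, for every $k\in\{1,\dots,m\}$ we have $$\mathbf T_k=R^k\mathbf A L^{k-1},\qquad \mathbf T_k\mathbf T_{k-1}\cdots\mathbf T_1=R^k\mathbf A^k,\qquad \mathbf T=\mathbf A^m .$$
   Context: All matrices are $m\times m$ real with rows and columns indexed $1,\dots,m$. $\mathbf A$ is the companion-type matrix with $\mathbf A_{i,i+1}=1$ for $1\le i\le m-1$, all other entries of rows $1,\dots,m-1$ equal to $0$, and last row $(\alpha_0,\alpha_1,\dots,\alpha_{m-1})$ (for $i=m$, $\mathbf A_{m,j}=\alpha_{j-1}$). For $k\in\{1,\dots,m\}$, $$(\mathbf T_k)_{i,j}=\begin{cases}\alpha_{m-k+j},&\text{if } i=k \text{ and } 1\le j<k;\\ \alpha_{j-k},&\text{if } i=k\text{ and } k\le j\le m;\\ 1,&\text{if } i\ne k\text{ and } j=i;\\ 0,&\text{otherwise.}\end{cases}$$ $R$ (right-shift) is the permutation matrix with $R_{1,m}=1$, $R_{i+1,i}=1$ for $1\le i\le m-1$, and all other entries $0$. $L$ (left-shift) is the permutation matrix with $L_{m,1}=1$, $L_{i,i+1}=1$ for $1\le i\le m-1$, and all other entries $0$. *)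

theory Defs
  imports Complex_Main "Jordan_Normal_Form.Matrix"
begin

text \<open>
  Matrices of the library have indices \<open>0, \<dots>, m - 1\<close>. Here \<open>f\<close> takes indices
  \<open>1, \<dots>, m\<close>, so all the definitions below are written with indices starting at 1.
\<close>

definition mat1 :: "nat \<Rightarrow> (nat \<Rightarrow> nat \<Rightarrow> real) \<Rightarrow> real mat" where
  "mat1 m f = mat m m (\<lambda>(i, j). f (i + 1) (j + 1))"

definition A_mat :: "nat \<Rightarrow> (nat \<Rightarrow> real) \<Rightarrow> real mat" where
  "A_mat m \<alpha> = mat1 m (\<lambda>i j.
     if i = m then \<alpha> (j - 1)
     else if j = i + 1 then 1
     else 0)"

definition T_mat :: "nat \<Rightarrow> (nat \<Rightarrow> real) \<Rightarrow> nat \<Rightarrow> real mat" where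
  "T_mat m \<alpha> k = mat1 m (\<lambda>i j.
     if i = k \<and> j < k then \<alpha> (m - k + j)
     else if i = k \<and> k \<le> j then \<alpha> (j - k)
     else if i \<noteq> k \<and> j = i then 1
     else 0)"

text \<open>The product with decreasing indices from left to right, \<open>T\<^sub>k T\<^sub>k\<^sub>-\<^sub>1 \<cdots> T\<^sub>1\<close>.\<close>

primrec T_prod :: "nat \<Rightarrow> (nat \<Rightarrow> real) \<Rightarrow> nat \<Rightarrow> real mat" where
  "T_prod m \<alpha> 0 = 1\<^sub>m m"
| "T_prod m \<alpha> (Suc k) = T_mat m \<alpha> (Suc k) * T_prod m \<alpha> k"

definition T_full :: "nat \<Rightarrow> (nat \<Rightarrow> real) \<Rightarrow> real mat" where
  "T_full m \<alpha> = T_prod m \<alpha> m"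

definition R_mat :: "nat \<Rightarrow> real mat" where
  "R_mat m = mat1 m (\<lambda>i j. if (i = 1 \<and> j = m) \<or> i = j + 1 then 1 else 0)"

definition L_mat :: "nat \<Rightarrow> real mat" where
  "L_mat m = mat1 m (\<lambda>i j. if (i = m \<and> j = 1) \<or> j = i + 1 then 1 else 0)"

end

theory Submission
  imports Defs "Jordan_Normal_Form.Determinant"
begin

text \<open>
  The matrix \<open>R\<close> moves every row of a matrix one step down cyclically, and right multiplication by
  \<open>L\<close> moves every column one step to the right. Both \<open>T\<^sub>1\<close> and \<open>R A\<close> have first row
  \<open>(\<alpha>\<^sub>0, \<dots>, \<alpha>\<^sub>m\<^sub>-\<^sub>1)\<close> and coincide with the identity below it. Conjugation by \<open>R\<close> shifts matrices along the
  diagonal: the special row of \<open>T\<^sub>k\<close> moves to position \<open>k + 1\<close> with its entries rotated by one step, and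
  the identity rows stay identity rows. Hence \<open>T\<^sub>k\<^sub>+\<^sub>1 = R T\<^sub>k L\<close>, which iterates to
  \<open>T\<^sub>k = R\<^sup>k A L\<^sup>k\<^sup>-\<^sup>1\<close>.

  As \<open>L\<close> is the inverse of \<open>R\<close>, the product telescopes:
  \<open>T\<^sub>k\<^sub>+\<^sub>1 (R\<^sup>k A\<^sup>k) = R\<^sup>k\<^sup>+\<^sup>1 A (L\<^sup>k R\<^sup>k) A\<^sup>k = R\<^sup>k\<^sup>+\<^sup>1 A\<^sup>k\<^sup>+\<^sup>1\<close>. For \<open>k = m\<close> the factor
  \<open>R\<^sup>m\<close> disappears, since \<open>m\<close> cyclic steps return every row to its place.
\<close>

lemma pow_mat_Suc_left:
  assumes "A \<in> carrier_mat n n"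
  shows "A ^\<^sub>m Suc k = A * A ^\<^sub>m k"
proof (induction k)
  case 0
  then show ?case using assms by simp
next
  case (Suc k)
  have "A ^\<^sub>m Suc (Suc k) = (A * A ^\<^sub>m k) * A"
    using Suc by simp
  also have "\<dots> = A * (A ^\<^sub>m k * A)"
    using assms by (intro assoc_mult_mat[of _ n n _ n _ n]) auto
  finally show ?case by simp
qed

lemma pow_mat_left_inverse:
  assumes A: "A \<in> carrier_mat n n" and B: "B \<in> carrier_mat n n" and inv: "A * B = 1\<^sub>m n"
  shows "A ^\<^sub>m k * B ^\<^sub>m k = 1\<^sub>m n"
proof (induction k)
  case 0
  then show ?case using A B by simp
next
  case (Suc k)
  have Ak: "A ^\<^sub>m k \<in> carrier_mat n n" and Bk: "B ^\<^sub>m k \<in> carrier_mat n n"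
    using A B by auto
  have "A ^\<^sub>m Suc k * B ^\<^sub>m Suc k = (A ^\<^sub>m k * A) * (B * B ^\<^sub>m k)"
    by (simp add: pow_mat_Suc_left[OF B, symmetric])
  also have "\<dots> = A ^\<^sub>m k * ((A * B) * B ^\<^sub>m k)"
    using A B Ak Bk by (simp add: assoc_mult_mat[of _ n n _ n _ n] mult_carrier_mat[of _ n n])
  also have "\<dots> = 1\<^sub>m n"
    using Suc by (simp add: inv left_mult_one_mat[OF Bk])
  finally show ?case .
qed

lemma carrier_mats [simp]:
  "A_mat m \<alpha> \<in> carrier_mat m m" "T_mat m \<alpha> k \<in> carrier_mat m m"
  "R_mat m \<in> carrier_mat m m" "L_mat m \<in> carrier_mat m m"
  by (simp_all add: A_mat_def T_mat_def R_mat_def L_mat_def mat1_def)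

lemma dim_mats [simp]:
  "dim_row (A_mat m \<alpha>) = m" "dim_col (A_mat m \<alpha>) = m"
  "dim_row (T_mat m \<alpha> k) = m" "dim_col (T_mat m \<alpha> k) = m"
  "dim_row (R_mat m) = m" "dim_col (R_mat m) = m"
  "dim_row (L_mat m) = m" "dim_col (L_mat m) = m"
  using carrier_mats by blast+

lemma R_mult_index:
  assumes M: "M \<in> carrier_mat m n" and i: "i < m" and j: "j < n"
  shows "(R_mat m * M) $$ (i, j) = M $$ (if i = 0 then m - 1 else i - 1, j)"
proof -
  let ?p = "if i = 0 then m - 1 else i - 1"
  have "(R_mat m * M) $$ (i, j) = (\<Sum>l<m. R_mat m $$ (i, l) * M $$ (l, j))"
    using assms by (auto simp: scalar_prod_def atLeast0LessThan intro!: sum.cong)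
  also have "\<dots> = (\<Sum>l<m. if l = ?p then M $$ (l, j) else 0)"
    using i by (intro sum.cong) (auto simp: R_mat_def mat1_def)
  also have "\<dots> = M $$ (?p, j)"
    using i by (subst sum.delta) auto
  finally show ?thesis .
qed

lemma mult_L_index:
  assumes M: "M \<in> carrier_mat n m" and i: "i < n" and j: "j < m"
  shows "(M * L_mat m) $$ (i, j) = M $$ (i, if j = 0 then m - 1 else j - 1)"
proof -
  let ?p = "if j = 0 then m - 1 else j - 1"
  have "(M * L_mat m) $$ (i, j) = (\<Sum>l<m. M $$ (i, l) * L_mat m $$ (l, j))"
    using assms by (auto simp: scalar_prod_def atLeast0LessThan intro!: sum.cong)
  also have "\<dots> = (\<Sum>l<m. if l = ?p then M $$ (i, l) else 0)"
    using j by (intro sum.cong) (auto simp: L_mat_def mat1_def)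
  also have "\<dots> = M $$ (i, ?p)"
    using j by (subst sum.delta) auto
  finally show ?thesis .
qed

text \<open>
  The shift formulas for \<open>R\<close> and \<open>L\<close> give the entries of \<open>R L\<close>, whereas the telescoping uses \<open>L R\<close>;
  a one-sided inverse of a square matrix is two-sided.
\<close>

lemma L_mult_R: "L_mat m * R_mat m = 1\<^sub>m m"
proof -
  have "R_mat m * L_mat m = 1\<^sub>m m"
  proof (rule eq_matI)
    fix i j assume "i < dim_row (1\<^sub>m m :: real mat)" "j < dim_col (1\<^sub>m m :: real mat)"
    then have i: "i < m" and j: "j < m" by auto
    show "(R_mat m * L_mat m) $$ (i, j) = 1\<^sub>m m $$ (i, j)"
      using i j
      by (subst mult_L_index[of _ m]) (auto simp: R_mat_def mat1_def)
  qed auto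
  then show ?thesis
    by (intro mat_mult_left_right_inverse[of "R_mat m"]) auto
qed

text \<open>
  The exponent is at most \<open>m\<close>, so that the cyclic shift by \<open>k\<close> passes the last index at most once and
  no reduction modulo \<open>m\<close> is required.
\<close>

lemma R_pow_index:
  assumes "k \<le> m" "i < m" "j < m"
  shows "(R_mat m ^\<^sub>m k) $$ (i, j) = (if i = j + k \<or> i + m = j + k then 1 else 0)"
  using assms
proof (induction k arbitrary: i)
  case 0
  then show ?case by auto
next
  case (Suc k)
  have "(R_mat m ^\<^sub>m Suc k) $$ (i, j) = (R_mat m ^\<^sub>m k) $$ (if i = 0 then m - 1 else i - 1, j)"
    unfolding pow_mat_Suc_left[OF carrier_mats(3)]
    using Suc.prems by (intro R_mult_index[of _ m m] pow_carrier_mat carrier_mats) auto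
  also have "\<dots> = (if i = j + Suc k \<or> i + m = j + Suc k then 1 else 0)"
    using Suc.prems by (subst Suc.IH) auto
  finally show ?case .
qed

lemma R_pow_m: "R_mat m ^\<^sub>m m = 1\<^sub>m m"
  by (rule eq_matI) (auto simp: R_pow_index)

lemma T_mat_1:
  assumes "m > 0"
  shows "T_mat m \<alpha> 1 = R_mat m * A_mat m \<alpha>"
proof (rule eq_matI)
  fix i j assume "i < dim_row (R_mat m * A_mat m \<alpha>)" "j < dim_col (R_mat m * A_mat m \<alpha>)"
  then have "i < m" "j < m" by auto
  then show "T_mat m \<alpha> 1 $$ (i, j) = (R_mat m * A_mat m \<alpha>) $$ (i, j)"
    by (subst R_mult_index[of _ m m]) (auto simp: T_mat_def A_mat_def mat1_def)
qed auto

text \<open>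
  The piecewise form of row \<open>k\<close> of \<open>T\<^sub>k\<close> is the cyclic rotation of \<open>\<alpha>\<close> that places \<open>\<alpha>\<^sub>0\<close> on the
  diagonal, so conjugation by \<open>R\<close> maps it to row \<open>k + 1\<close> of \<open>T\<^sub>k\<^sub>+\<^sub>1\<close>.
\<close>

lemma T_mat_Suc:
  assumes k: "1 \<le> k" "k < m"
  shows "T_mat m \<alpha> (Suc k) = R_mat m * T_mat m \<alpha> k * L_mat m"
proof (rule eq_matI)
  fix i j
  assume "i < dim_row (R_mat m * T_mat m \<alpha> k * L_mat m)" "j < dim_col (R_mat m * T_mat m \<alpha> k * L_mat m)"
  then have i: "i < m" and j: "j < m" by auto
  let ?p = "\<lambda>i. if i = 0 then m - 1 else i - 1"
  have "(R_mat m * T_mat m \<alpha> k * L_mat m) $$ (i, j) = (R_mat m * T_mat m \<alpha> k) $$ (i, ?p j)"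
    using i j by (intro mult_L_index[of _ m]) auto
  also have "\<dots> = T_mat m \<alpha> k $$ (?p i, ?p j)"
    using i j by (intro R_mult_index[of _ m m]) auto
  also have "\<dots> = T_mat m \<alpha> (Suc k) $$ (i, j)"
    using i j k by (auto simp: T_mat_def mat1_def Suc_diff_Suc)
  finally show "T_mat m \<alpha> (Suc k) $$ (i, j) = (R_mat m * T_mat m \<alpha> k * L_mat m) $$ (i, j)" ..
qed auto

lemma T_mat_eq:
  assumes "k < m"
  shows "T_mat m \<alpha> (Suc k) = R_mat m ^\<^sub>m Suc k * A_mat m \<alpha> * L_mat m ^\<^sub>m k"
  using assms
proof (induction k)
  case 0
  then show ?case
    using T_mat_1[of m \<alpha>] by (simp add: mult_carrier_mat[of _ m m])
next
  case (Suc k)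
  let ?R = "R_mat m" and ?L = "L_mat m" and ?A = "A_mat m \<alpha>"
  have carr: "?R ^\<^sub>m Suc k \<in> carrier_mat m m" "?L ^\<^sub>m k \<in> carrier_mat m m"
    using carrier_mats by (metis pow_carrier_mat)+
  have "T_mat m \<alpha> (Suc (Suc k)) = ?R * (?R ^\<^sub>m Suc k * ?A * ?L ^\<^sub>m k) * ?L"
    using Suc T_mat_Suc[of "Suc k" m \<alpha>] by simp
  also have "\<dots> = (?R * ?R ^\<^sub>m Suc k) * ?A * (?L ^\<^sub>m k * ?L)"
    using carr by (simp add: assoc_mult_mat[of _ m m _ m _ m] mult_carrier_mat[of _ m m] del: pow_mat.simps)
  also have "?R * ?R ^\<^sub>m Suc k = ?R ^\<^sub>m Suc (Suc k)"
    by (rule pow_mat_Suc_left[OF carrier_mats(3), symmetric])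
  finally show ?case by simp
qed

lemma T_prod_eq:
  assumes "k \<le> m"
  shows "T_prod m \<alpha> k = R_mat m ^\<^sub>m k * A_mat m \<alpha> ^\<^sub>m k"
  using assms
proof (induction k)
  case 0
  then show ?case by simp
next
  case (Suc k)
  let ?R = "R_mat m" and ?L = "L_mat m" and ?A = "A_mat m \<alpha>"
  have carr: "?R ^\<^sub>m Suc k \<in> carrier_mat m m" "?R ^\<^sub>m k \<in> carrier_mat m m"
      "?L ^\<^sub>m k \<in> carrier_mat m m" "?A ^\<^sub>m k \<in> carrier_mat m m"
    using carrier_mats by (metis pow_carrier_mat)+
  have "T_prod m \<alpha> (Suc k) = (?R ^\<^sub>m Suc k * ?A * ?L ^\<^sub>m k) * (?R ^\<^sub>m k * ?A ^\<^sub>m k)"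
    using Suc T_mat_eq[of k m \<alpha>] by simp
  also have "\<dots> = ?R ^\<^sub>m Suc k * (?A * ((?L ^\<^sub>m k * ?R ^\<^sub>m k) * ?A ^\<^sub>m k))"
    using carr by (simp add: assoc_mult_mat[of _ m m _ m _ m] mult_carrier_mat[of _ m m] del: pow_mat.simps)
  also have "?L ^\<^sub>m k * ?R ^\<^sub>m k = 1\<^sub>m m"
    by (intro pow_mat_left_inverse L_mult_R carrier_mats)
  also have "?A * (1\<^sub>m m * ?A ^\<^sub>m k) = ?A ^\<^sub>m Suc k"
    using carr by (simp add: pow_mat_Suc_left[OF carrier_mats(1)] del: pow_mat.simps)
  finally show ?case .
qed

theorem proposition3p2:
  fixes m :: nat and \<alpha> :: "nat \<Rightarrow> real"
  assumes "m \<ge> 2"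
    and "\<And>i. i < m \<Longrightarrow> \<alpha> i \<ge> 0"
    and "(\<Sum>i<m. \<alpha> i) = 1"
  shows "(\<forall>k\<in>{1..m}.
             T_mat m \<alpha> k = R_mat m ^\<^sub>m k * A_mat m \<alpha> * L_mat m ^\<^sub>m (k - 1)
           \<and> T_prod m \<alpha> k = R_mat m ^\<^sub>m k * A_mat m \<alpha> ^\<^sub>m k)
         \<and> T_full m \<alpha> = A_mat m \<alpha> ^\<^sub>m m"
proof (intro conjI ballI)
  fix k assume k: "k \<in> {1..m}"
  then have "k - 1 < m" "Suc (k - 1) = k" by auto
  then show "T_mat m \<alpha> k = R_mat m ^\<^sub>m k * A_mat m \<alpha> * L_mat m ^\<^sub>m (k - 1)"
    using T_mat_eq[of "k - 1" m \<alpha>] by metis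
  show "T_prod m \<alpha> k = R_mat m ^\<^sub>m k * A_mat m \<alpha> ^\<^sub>m k"
    using k by (intro T_prod_eq) auto
next
  have "A_mat m \<alpha> ^\<^sub>m m \<in> carrier_mat m m"
    by (intro pow_carrier_mat carrier_mats)
  then show "T_full m \<alpha> = A_mat m \<alpha> ^\<^sub>m m"
    by (simp add: T_full_def T_prod_eq R_pow_m)
qed

end
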